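(* Let $X$ be a real Banach space and let $x=(x_n)_{n\in\mathbb{N}}\in \ell^1(X)$ be a non-zero element. Let $T:\ell^1(X)\to\mathbb{R}$ be a map. Then $T\in J(x)$ if and only if there exists $(F_n)_{n\in\mathbb{N}}\in \ell^{\infty}(X^* )$ with $\|F_n\|\leq 1$ for all $n\in\mathbb{N}$ and $F_n\in J(x_n)$ for all $n\in\mathbb{N}$ such that $x_n\neq 0$, for which $$T((y_n))=\sum_{n\in\mathbb{N}}F_n(y_n)\quad\text{for every } (y_n)\in\ell^1(X).$$
   Context: For a Banach space $X$, $\ell^1(X)$ is the Banach space of sequences $(x_n)_{n\in\mathbb{N}}$ in $X$ with $\|(x_n)\|=\sum_n\|x_n\|<\infty$, and $\ell^\infty(X^* )$ is the Banach space of bounded sequences in the dual $X^*$ with the supremum norm. For a non-zero element $z$ of a Banach space $Y$, $J(z)=\{f\in Y^*:\|f\|=1,\ f(z)=\|z\|\}$ denotes the set of support functionals at $z$; here $J(x)\subseteq \ell^1(X)^*$ and $J(x_n)\subseteq X^*$. *)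

theory Defs
  imports "HOL-Analysis.Analysis"
begin

section \<open>The Banach space of absolutely summable sequences\<close>

typedef (overloaded) ('a::real_normed_vector) ell1 =
  "{x :: nat \<Rightarrow> 'a. summable (\<lambda>n. norm (x n))}"
  morphisms ell1_nth Abs_ell1
  by (rule exI[of _ "\<lambda>_. 0"]) simp

setup_lifting type_definition_ell1

lemma summable_norm_ell1_nth [simp, intro]: "summable (\<lambda>n. norm (ell1_nth x n))"
  using ell1_nth[of x] by simp

lemma summable_norm_add:
  fixes x y :: "nat \<Rightarrow> 'a::real_normed_vector"
  assumes "summable (\<lambda>n. norm (x n))" "summable (\<lambda>n. norm (y n))"
  shows "summable (\<lambda>n. norm (x n + y n))"
  by (rule summable_comparison_test'[OF summable_add[OF assms], of 0]) (simp add: norm_triangle_ineq)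

instantiation ell1 :: (real_normed_vector) real_vector
begin

lift_definition zero_ell1 :: "'a ell1" is "\<lambda>_. 0"
  by simp

lift_definition plus_ell1 :: "'a ell1 \<Rightarrow> 'a ell1 \<Rightarrow> 'a ell1" is "\<lambda>x y n. x n + y n"
  by (rule summable_norm_add)

lift_definition uminus_ell1 :: "'a ell1 \<Rightarrow> 'a ell1" is "\<lambda>x n. - x n"
  by simp

lift_definition minus_ell1 :: "'a ell1 \<Rightarrow> 'a ell1 \<Rightarrow> 'a ell1" is "\<lambda>x y n. x n - y n"
proof -
  fix x y :: "nat \<Rightarrow> 'a"
  assume "summable (\<lambda>n. norm (x n))" "summable (\<lambda>n. norm (y n))"
  then show "summable (\<lambda>n. norm (x n - y n))"
    using summable_norm_add[of x "\<lambda>n. - y n"] by simp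
qed

lift_definition scaleR_ell1 :: "real \<Rightarrow> 'a ell1 \<Rightarrow> 'a ell1" is "\<lambda>r x n. r *\<^sub>R x n"
  by (simp add: summable_mult)

instance
  by standard (transfer, simp add: algebra_simps fun_eq_iff)+

end

instantiation ell1 :: (real_normed_vector) real_normed_vector
begin

lift_definition norm_ell1 :: "'a ell1 \<Rightarrow> real" is "\<lambda>x. \<Sum>n. norm (x n)" .

definition dist_ell1 :: "'a ell1 \<Rightarrow> 'a ell1 \<Rightarrow> real"
  where "dist_ell1 x y = norm (x - y)"

definition uniformity_ell1 :: "('a ell1 \<times> 'a ell1) filter"
  where "uniformity_ell1 = (INF e\<in>{0 <..}. principal {(x, y). dist x y < e})"

definition open_ell1 :: "'a ell1 set \<Rightarrow> bool"
  where "open_ell1 S = (\<forall>x\<in>S. \<forall>\<^sub>F (x', y) in uniformity. x' = x \<longrightarrow> y \<in> S)"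

definition sgn_ell1 :: "'a ell1 \<Rightarrow> 'a ell1"
  where "sgn_ell1 x = inverse (norm x) *\<^sub>R x"

instance
proof
  fix a :: real and x y :: "'a ell1"
  show "dist x y = norm (x - y)" by (rule dist_ell1_def)
  show "sgn x = x /\<^sub>R norm x" by (rule sgn_ell1_def)
  show "uniformity = (INF e\<in>{0 <..}. principal {(x, y :: 'a ell1). dist x y < e})"
    by (rule uniformity_ell1_def)
  show "open S = (\<forall>x\<in>S. \<forall>\<^sub>F (x', y) in uniformity. x' = x \<longrightarrow> y \<in> S)" for S :: "'a ell1 set"
    by (rule open_ell1_def)
  show "norm x = 0 \<longleftrightarrow> x = 0"
    by transfer (auto simp: suminf_eq_zero_iff fun_eq_iff)
  show "norm (a *\<^sub>R x) = \<bar>a\<bar> * norm x"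
    by transfer (simp add: suminf_mult)
  show "norm (x + y) \<le> norm x + norm y"
  proof transfer
    fix x y :: "nat \<Rightarrow> 'a"
    assume *: "summable (\<lambda>n. norm (x n))" "summable (\<lambda>n. norm (y n))"
    have "(\<Sum>n. norm (x n + y n)) \<le> (\<Sum>n. norm (x n) + norm (y n))"
      by (intro suminf_le summable_norm_add summable_add * norm_triangle_ineq)
    then show "(\<Sum>n. norm (x n + y n)) \<le> (\<Sum>n. norm (x n)) + (\<Sum>n. norm (y n))"
      using suminf_add[OF *] by simp
  qed
qed

end

lemma sum_norm_ell1_nth_le: "(\<Sum>k<K. norm (ell1_nth x k)) \<le> norm x"
  unfolding norm_ell1.rep_eq by (intro sum_le_suminf) auto

lemma norm_ell1_nth_le: "norm (ell1_nth x k) \<le> norm x"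
proof -
  have "norm (ell1_nth x k) \<le> (\<Sum>j<Suc k. norm (ell1_nth x j))"
    by (simp add: sum_nonneg)
  also have "\<dots> \<le> norm x" by (rule sum_norm_ell1_nth_le)
  finally show ?thesis .
qed

instance ell1 :: (banach) banach
proof
  fix X :: "nat \<Rightarrow> 'a ell1"
  assume X: "Cauchy X"
  have "convergent (\<lambda>n. ell1_nth (X n) k)" for k
  proof (rule Cauchy_convergent, rule CauchyI)
    fix e :: real assume "e > 0"
    then obtain N where N: "\<And>m n. m \<ge> N \<Longrightarrow> n \<ge> N \<Longrightarrow> norm (X m - X n) < e"
      using CauchyD[OF X] by blast
    have "norm (ell1_nth (X m) k - ell1_nth (X n) k) < e" if "m \<ge> N" "n \<ge> N" for m n
      using N[OF that] norm_ell1_nth_le[of "X m - X n" k] by (simp add: minus_ell1.rep_eq)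
    then show "\<exists>N. \<forall>m\<ge>N. \<forall>n\<ge>N. norm (ell1_nth (X m) k - ell1_nth (X n) k) < e" by blast
  qed
  then obtain l where l: "\<And>k. (\<lambda>n. ell1_nth (X n) k) \<longlonglongrightarrow> l k"
    unfolding convergent_def by metis
  have key: "\<exists>N. \<forall>m\<ge>N. \<forall>K. (\<Sum>k<K. norm (ell1_nth (X m) k - l k)) \<le> e" if "e > 0" for e :: real
  proof -
    obtain N where N: "\<And>m n. m \<ge> N \<Longrightarrow> n \<ge> N \<Longrightarrow> norm (X m - X n) < e"
      using CauchyD[OF X \<open>e > 0\<close>] by blast
    have "(\<Sum>k<K. norm (ell1_nth (X m) k - l k)) \<le> e" if "m \<ge> N" for m K
    proof (rule LIMSEQ_le_const2)
      show "(\<lambda>n. \<Sum>k<K. norm (ell1_nth (X m) k - ell1_nth (X n) k))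
        \<longlonglongrightarrow> (\<Sum>k<K. norm (ell1_nth (X m) k - l k))"
        by (intro tendsto_sum tendsto_norm tendsto_diff tendsto_const l)
      have "(\<Sum>k<K. norm (ell1_nth (X m) k - ell1_nth (X n) k)) \<le> e" if "n \<ge> N" for n
        using N[OF \<open>m \<ge> N\<close> that] sum_norm_ell1_nth_le[of "X m - X n" K]
        by (simp add: minus_ell1.rep_eq)
      then show "\<exists>N. \<forall>n\<ge>N. (\<Sum>k<K. norm (ell1_nth (X m) k - ell1_nth (X n) k)) \<le> e" by blast
    qed
    then show ?thesis by blast
  qed
  have sm: "summable (\<lambda>k. norm (ell1_nth (X m) k - l k))"
    if "\<forall>K. (\<Sum>k<K. norm (ell1_nth (X m) k - l k)) \<le> e" for m and e :: real
    using that by (intro summableI_nonneg_bounded[of _ e]) auto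
  obtain M where M: "\<forall>K. (\<Sum>k<K. norm (ell1_nth (X M) k - l k)) \<le> 1"
    using key[of 1] by auto
  have "summable (\<lambda>k. norm (l k))"
  proof -
    have "summable (\<lambda>k. norm (- (ell1_nth (X M) k - l k) + ell1_nth (X M) k))"
      by (rule summable_norm_add) (use sm[OF M] in \<open>auto simp: norm_minus_commute\<close>)
    then show ?thesis by simp
  qed
  then have L: "ell1_nth (Abs_ell1 l) = l" by (simp add: Abs_ell1_inverse)
  have "X \<longlonglongrightarrow> Abs_ell1 l"
  proof (rule LIMSEQ_I)
    fix e :: real assume "e > 0"
    then obtain N where N: "\<forall>m\<ge>N. \<forall>K. (\<Sum>k<K. norm (ell1_nth (X m) k - l k)) \<le> e / 2"
      using key[of "e / 2"] by auto
    have "norm (X m - Abs_ell1 l) < e" if "m \<ge> N" for m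
    proof -
      have *: "\<forall>K. (\<Sum>k<K. norm (ell1_nth (X m) k - l k)) \<le> e / 2" using N that by blast
      have "norm (X m - Abs_ell1 l) = (\<Sum>k. norm (ell1_nth (X m) k - l k))"
        by (simp add: norm_ell1.rep_eq minus_ell1.rep_eq L)
      also have "\<dots> \<le> e / 2" using * by (intro suminf_le_const sm[OF *]) auto
      finally show ?thesis using \<open>e > 0\<close> by simp
    qed
    then show "\<exists>N. \<forall>m\<ge>N. norm (X m - Abs_ell1 l) < e" by blast
  qed
  then show "convergent X" unfolding convergent_def by blast
qed

section \<open>Bounded sequences and support functionals\<close>

text \<open>Since \<^typ>\<open>nat\<close> carries the discrete topology, bounded continuous functions on it are
  exactly the bounded sequences, and their library norm is the supremum norm.\<close>

type_synonym 'a ell_infinity = "nat \<Rightarrow>\<^sub>C 'a"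

lemma bcontfun_nat_iff: "(x :: nat \<Rightarrow> 'a::metric_space) \<in> bcontfun \<longleftrightarrow> bounded (range x)"
  by (simp add: bcontfun_def)

text \<open>The dual space is \<^typ>\<open>'a \<Rightarrow>\<^sub>L real\<close> with the operator norm. The notion is only meant for
  \<open>z \<noteq> 0\<close>; at \<open>z = 0\<close> the set below is the unit sphere of the dual.\<close>

definition support_functionals :: "'a::real_normed_vector \<Rightarrow> ('a \<Rightarrow>\<^sub>L real) set"
  where "support_functionals z = {f. norm f = 1 \<and> blinfun_apply f z = norm z}"

end

theory Submission
  imports Defs
begin

text \<open>
  The dual of \<open>\<ell>\<^sup>1(X)\<close> is \<open>\<ell>\<^sup>\<infinity>(X\<^sup>*)\<close>, acting by \<open>F(y) = \<Sum>n. F\<^sub>n(y\<^sub>n)\<close>, and under this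
  identification attaining the norm at \<open>x\<close> can only happen coordinatewise.

  A functional \<open>f\<close> on \<open>\<ell>\<^sup>1(X)\<close> restricts to the coordinate axes, giving functionals \<open>F\<^sub>n\<close> with
  \<open>\<parallel>F\<^sub>n\<parallel> \<le> \<parallel>f\<parallel>\<close>. Each \<open>y\<close> is the norm limit of its truncations (\<open>ell1_single_sums\<close>), so by
  continuity \<open>f\<close> is the sum of its coordinate functionals. If \<open>f\<close> supports \<open>x\<close>, then
  \<open>\<Sum>n. (\<parallel>x\<^sub>n\<parallel> - F\<^sub>n(x\<^sub>n)) = \<parallel>x\<parallel> - f(x) = 0\<close>. The terms are nonnegative because \<open>\<parallel>F\<^sub>n\<parallel> \<le> 1\<close>, so
  all of them vanish: \<open>F\<^sub>n(x\<^sub>n) = \<parallel>x\<^sub>n\<parallel>\<close> for every \<open>n\<close>.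

  Conversely, a sequence of functionals of norm at most 1 sums to a functional of norm at most 1
  on \<open>\<ell>\<^sup>1(X)\<close> (\<open>ell1_functional_of_coordinates\<close>), and if each \<open>F\<^sub>n\<close> attains \<open>\<parallel>x\<^sub>n\<parallel>\<close> at \<open>x\<^sub>n\<close>, the sum
  attains \<open>\<Sum>n. \<parallel>x\<^sub>n\<parallel> = \<parallel>x\<parallel>\<close> at \<open>x\<close>.

  In both directions one only has to check a norm bound and the value at the point, since attaining
  the norm of a nonzero vector forces norm exactly 1 (\<open>support_functionalsI\<close>).
\<close>

lemma support_functionalsI:
  fixes z :: "'a::real_normed_vector"
  assumes "z \<noteq> 0" "norm f \<le> 1" "blinfun_apply f z = norm z"
  shows "f \<in> support_functionals z"
proof -
  have "norm z \<le> norm f * norm z"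
    using norm_blinfun[of f z] assms(3) by simp
  then have "1 \<le> norm f" using \<open>z \<noteq> 0\<close> by simp
  then show ?thesis using assms by (simp add: support_functionals_def)
qed

lemma blinfun_apply_le_norm:
  fixes f :: "'a::real_normed_vector \<Rightarrow>\<^sub>L real"
  assumes "norm f \<le> 1"
  shows "\<bar>blinfun_apply f v\<bar> \<le> norm v"
  using norm_blinfun[of f v] mult_right_mono[OF assms norm_ge_zero[of v]] by simp

lift_definition ell1_single :: "nat \<Rightarrow> 'a::real_normed_vector \<Rightarrow> 'a ell1"
  is "\<lambda>n v k. if k = n then v else 0"
proof -
  fix n :: nat and v :: 'a
  show "summable (\<lambda>k. norm (if k = n then v else 0))"
    by (rule summable_finite[of "{n}"]) auto
qed

lemma norm_ell1_single [simp]: "norm (ell1_single n v) = norm v"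
proof transfer
  fix n :: nat and v :: 'a
  have "(\<Sum>k. norm (if k = n then v else 0)) = (\<Sum>k\<in>{n}. norm (if k = n then v else 0))"
    by (rule suminf_finite) auto
  then show "(\<Sum>k. norm (if k = n then v else 0)) = norm v" by simp
qed

lemma bounded_linear_ell1_single: "bounded_linear (ell1_single n)"
proof (rule bounded_linear_intro[where K = 1])
  show "ell1_single n (u + v) = ell1_single n u + ell1_single n v" for u v :: 'a
    by transfer (simp add: fun_eq_iff)
  show "ell1_single n (r *\<^sub>R v) = r *\<^sub>R ell1_single n v" for r and v :: 'a
    by transfer (simp add: fun_eq_iff)
qed simp

lemma ell1_nth_sum: "ell1_nth (\<Sum>i\<in>A. g i) k = (\<Sum>i\<in>A. ell1_nth (g i) k)"
  by (induction A rule: infinite_finite_induct) (simp_all add: zero_ell1.rep_eq plus_ell1.rep_eq)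

text \<open>The distance from \<open>y\<close> to its truncation at \<open>N\<close> is the tail
  \<open>\<parallel>y\<parallel> - (\<Sum>n<N. \<parallel>y\<^sub>n\<parallel>)\<close> of the convergent series \<open>\<parallel>y\<parallel>\<close>.\<close>

lemma ell1_single_sums:
  fixes y :: "'a::real_normed_vector ell1"
  shows "(\<lambda>n. ell1_single n (ell1_nth y n)) sums y"
proof -
  have dist: "norm ((\<Sum>n<N. ell1_single n (ell1_nth y n)) - y)
      = norm y - (\<Sum>n<N. norm (ell1_nth y n))" for N
  proof -
    have head: "(\<lambda>k. if k \<in> {..<N} then norm (ell1_nth y k) else 0)
        sums (\<Sum>n<N. norm (ell1_nth y n))"
      by (rule sums_If_finite_set) simp
    have full: "(\<lambda>k. norm (ell1_nth y k)) sums norm y"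
      by (simp add: norm_ell1.rep_eq summable_sums)
    have "norm (ell1_nth ((\<Sum>n<N. ell1_single n (ell1_nth y n)) - y) k)
        = norm (ell1_nth y k) - (if k \<in> {..<N} then norm (ell1_nth y k) else 0)" for k
      by (simp add: minus_ell1.rep_eq ell1_nth_sum ell1_single.rep_eq)
    with sums_diff[OF full head] show ?thesis
      by (simp add: norm_ell1.rep_eq sums_iff)
  qed
  have "(\<lambda>N. norm y - (\<Sum>n<N. norm (ell1_nth y n))) \<longlonglongrightarrow> norm y - norm y"
    unfolding norm_ell1.rep_eq by (intro tendsto_diff tendsto_const summable_LIMSEQ) simp
  then have "(\<lambda>N. norm ((\<Sum>n<N. ell1_single n (ell1_nth y n)) - y)) \<longlonglongrightarrow> 0"
    by (simp add: dist)
  then show ?thesis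
    unfolding sums_def by (subst LIM_zero_iff[symmetric]) (rule tendsto_norm_zero_cancel)
qed

text \<open>The norm bound holds because every vector of a coordinate axis has the same norm in
  \<open>\<ell>\<^sup>1(X)\<close> as in \<open>X\<close>.\<close>

lemma coordinates_of_ell1_functional:
  fixes f :: "'a::real_normed_vector ell1 \<Rightarrow>\<^sub>L real"
  obtains F :: "('a \<Rightarrow>\<^sub>L real) ell_infinity"
  where "\<And>n. norm (apply_bcontfun F n) \<le> norm f"
    and "\<And>y. (\<lambda>n. blinfun_apply (apply_bcontfun F n) (ell1_nth y n)) sums blinfun_apply f y"
proof -
  define G where "G n = Blinfun (\<lambda>v. blinfun_apply f (ell1_single n v))" for n
  have G: "blinfun_apply (G n) v = blinfun_apply f (ell1_single n v)" for n v
    unfolding G_def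
    by (subst bounded_linear_Blinfun_apply)
      (auto intro: bounded_linear_compose[OF blinfun.bounded_linear_right bounded_linear_ell1_single])
  have bound: "norm (G n) \<le> norm f" for n
    by (rule norm_blinfun_bound) (use norm_blinfun[of f "ell1_single n v" for v] in \<open>auto simp: G\<close>)
  then have "G \<in> bcontfun"
    unfolding bcontfun_nat_iff by (auto intro!: boundedI)
  then have app: "apply_bcontfun (Bcontfun G) = G"
    by (rule Bcontfun_inverse)
  have "(\<lambda>n. blinfun_apply (G n) (ell1_nth y n)) sums blinfun_apply f y" for y
    unfolding G by (rule bounded_linear.sums[OF blinfun.bounded_linear_right ell1_single_sums])
  with bound show thesis by (intro that[of "Bcontfun G"]) (simp_all add: app)
qed

lemma ell1_functional_of_coordinates:
  fixes F :: "nat \<Rightarrow> ('a::real_normed_vector \<Rightarrow>\<^sub>L real)" and T :: "'a ell1 \<Rightarrow> real"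
  assumes bound: "\<And>n. norm (F n) \<le> 1"
    and T: "\<And>y. (\<lambda>n. blinfun_apply (F n) (ell1_nth y n)) sums T y"
  obtains f where "T = blinfun_apply f" "norm f \<le> 1"
proof -
  have le: "\<bar>T y\<bar> \<le> norm y" for y
  proof -
    have "norm (\<Sum>n. blinfun_apply (F n) (ell1_nth y n)) \<le> (\<Sum>n. norm (ell1_nth y n))"
      by (rule norm_suminf_le) (simp_all add: blinfun_apply_le_norm[OF bound])
    then show ?thesis using T[of y] by (simp add: norm_ell1.rep_eq sums_iff)
  qed
  have "bounded_linear T"
  proof (rule bounded_linear_intro[where K = 1])
    show "T (y + z) = T y + T z" for y z
      using sums_unique2[OF T[of "y + z"]] sums_add[OF T[of y] T[of z]]
      by (simp add: plus_ell1.rep_eq blinfun.add_right)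
    show "T (r *\<^sub>R y) = r *\<^sub>R T y" for r y
      using sums_unique2[OF T[of "r *\<^sub>R y"]] sums_mult[OF T[of y], of r]
      by (simp add: scaleR_ell1.rep_eq blinfun.scaleR_right)
  qed (simp add: le)
  then have app: "blinfun_apply (Blinfun T) = T"
    by (rule bounded_linear_Blinfun_apply)
  have "norm (Blinfun T) \<le> 1"
    by (rule norm_blinfun_bound) (simp_all add: app le)
  with app show thesis by (intro that[of "Blinfun T"]) simp_all
qed

text \<open>The norm \<open>\<parallel>x\<parallel>\<close> is the sum of the \<open>\<parallel>x\<^sub>n\<parallel>\<close>, each an upper bound for \<open>F\<^sub>n(x\<^sub>n)\<close>, so no
  coordinate can make up for a loss in another.\<close>

lemma attains_norm_iff_coordinatewise:
  fixes F :: "nat \<Rightarrow> ('a::real_normed_vector \<Rightarrow>\<^sub>L real)" and x :: "'a ell1"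
  assumes bound: "\<And>n. norm (F n) \<le> 1"
    and s: "(\<lambda>n. blinfun_apply (F n) (ell1_nth x n)) sums s"
  shows "s = norm x \<longleftrightarrow> (\<forall>n. blinfun_apply (F n) (ell1_nth x n) = norm (ell1_nth x n))"
proof -
  let ?d = "\<lambda>n. norm (ell1_nth x n) - blinfun_apply (F n) (ell1_nth x n)"
  have d: "?d sums (norm x - s)"
    by (rule sums_diff[OF _ s]) (simp add: norm_ell1.rep_eq summable_sums)
  have "0 \<le> ?d n" for n
    using blinfun_apply_le_norm[OF bound, of n "ell1_nth x n"] by simp
  then have "suminf ?d = 0 \<longleftrightarrow> (\<forall>n. ?d n = 0)"
    using d by (intro suminf_eq_zero_iff) (simp_all add: sums_iff)
  with d show ?thesis by (auto simp: sums_iff)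
qed

theorem lemma3p1:
  fixes x :: "('a::banach) ell1" and T :: "'a ell1 \<Rightarrow> real"
  assumes "x \<noteq> 0"
  shows "T \<in> blinfun_apply ` support_functionals x \<longleftrightarrow>
    (\<exists>F :: ('a \<Rightarrow>\<^sub>L real) ell_infinity.
      (\<forall>n. norm (apply_bcontfun F n) \<le> 1) \<and>
      (\<forall>n. ell1_nth x n \<noteq> 0 \<longrightarrow> apply_bcontfun F n \<in> support_functionals (ell1_nth x n)) \<and>
      (\<forall>y. (\<lambda>n. blinfun_apply (apply_bcontfun F n) (ell1_nth y n)) sums T y))"
    (is "?L \<longleftrightarrow> (\<exists>F. ?R F)")
proof
  assume ?L
  then obtain f where f: "T = blinfun_apply f" "norm f = 1" "blinfun_apply f x = norm x"
    by (auto simp: support_functionals_def)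
  obtain F :: "('a \<Rightarrow>\<^sub>L real) ell_infinity"
    where bound: "\<And>n. norm (apply_bcontfun F n) \<le> 1"
      and sums: "\<And>y. (\<lambda>n. blinfun_apply (apply_bcontfun F n) (ell1_nth y n)) sums T y"
    using coordinates_of_ell1_functional[of f] f by metis
  have "\<forall>n. blinfun_apply (apply_bcontfun F n) (ell1_nth x n) = norm (ell1_nth x n)"
    using attains_norm_iff_coordinatewise[OF bound sums] f by simp
  with bound sums have "?R F" by (auto intro: support_functionalsI)
  then show "\<exists>F. ?R F" ..
next
  assume "\<exists>F. ?R F"
  then obtain F where F: "?R F" ..
  then obtain f where f: "T = blinfun_apply f" "norm f \<le> 1"
    using ell1_functional_of_coordinates[of "apply_bcontfun F" T] by blast
  have "blinfun_apply (apply_bcontfun F n) (ell1_nth x n) = norm (ell1_nth x n)" for n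
    using F by (cases "ell1_nth x n = 0") (auto simp: support_functionals_def)
  then have "T x = norm x"
    using attains_norm_iff_coordinatewise[of "apply_bcontfun F" x "T x"] F by blast
  with f \<open>x \<noteq> 0\<close> have "f \<in> support_functionals x"
    by (intro support_functionalsI) simp_all
  with f show ?L by blast
qed

end
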